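(* Let $X,Y\subseteq\mathbb{R}^d$. Let $\mu$ be a probability measure on $X$ that is absolutely continuous with respect to Lebesgue measure and whose support is contained in a convex compact set $A\subseteq X$. Let $\nu$ be a probability measure on $Y$ with exactly $n\ge 2$ non-zero values, located at the distinct points $\mathbf{y}_1,\dots,\mathbf{y}_n\in Y$. Let the ground cost be $c(\mathbf{x},\mathbf{y})=\|\mathbf{x}-\mathbf{y}\|_p$ with $p\in(1,\infty)$. Then the semi-discrete optimal transport problem for $(\mu,\nu,c)$ has an associated (optimal) transport map $T$, a function $F(\mathbf{x})=\max_{1\le i\le n}\{a_i-c(\mathbf{x},\mathbf{y}_i)\}$ for some finite shifts $a_1,\dots,a_n$, and sets $A_i=\{\mathbf{x}\in A: F(\mathbf{x})=a_i-c(\mathbf{x},\mathbf{y}_i)\}$, $i=1,\dots,n$, such that for all $\mathbf{x}\in A$, $$\mathbf{x}\in\mathring{A}_i \text{ for some } i\in\{1,\dots,n\}\quad\Longrightarrow\quad T(\mathbf{x})=\mathbf{y}_i .$$ In other words, $F$ induces a $\mu$-partition of $A$, and $T$ agrees with $F$ on $A\setminus B$. Furthermore, $T$ is unique $\mu$-a.e.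
   Context: Transport plans: $\Pi(\mu,\nu)$ is the set of probability measures on $X\times Y$ with marginals $\mu$ and $\nu$. The Monge-Kantorovich problem is to minimize $\int_{X\times Y} c\,d\pi$ over $\pi\in\Pi(\mu,\nu)$. An optimal transport map (Monge solution) is a measurable map $T:X\to Y$ such that the plan $(\mathrm{Id}\times T)_{\#}\mu$ belongs to $\Pi(\mu,\nu)$ and is a minimizer. Boundary sets: $A_{ij}=A_i\cap A_j$ for $i\ne j$; the boundary set is $B=\bigcup_{1\le i<j\le n}A_{ij}$; the strict interior of $A_i$ is $\mathring{A}_i=A_i\setminus B$. $F$ induces a $\mu$-partition of $A$ if: (1) $\mu(A)<\infty$; (2) $\mu(A_{ij})=0$ for all $i\neq j$; (3) $\sum_{i=1}^n\mu(A_i)=\mu(A)$; and (4) $\mu(A_i)=\nu(\mathbf{y}_i)>0$ for all $i$. "$T$ agrees with $F$ on $A\setminus B$" means that $T(\mathbf{x})=\mathbf{y}_i$ whenever $\mathbf{x}\in\mathring{A}_i$.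
   Formalization: The formal theorem assumes d ≥ 2; for d = 1 the claim fails, e.g. μ uniform on A = X = [0,1] and ν giving mass 1/2 to each of 2 and 3, where no shifts induce a μ-partition and the optimal map is not unique. *)

theory Defs
  imports "HOL-Probability.Probability"
begin

definition lp_norm :: "real \<Rightarrow> real ^ 'd \<Rightarrow> real" where
  "lp_norm p x = (\<Sum>k\<in>UNIV. \<bar>x $ k\<bar> powr p) powr (1 / p)"

text \<open>A measure on a subset \<open>X\<close> of the ambient space is a measure with space \<open>X\<close> and the Borel
  sigma-algebra of the subspace topology, \<open>restrict_space borel X\<close>; \<open>X\<close> need not be a Borel set.\<close>

definition borel_prob_on :: "'a :: topological_space set \<Rightarrow> 'a measure \<Rightarrow> bool" where
  "borel_prob_on X M \<longleftrightarrow> prob_space M \<and> sets M = sets (restrict_space borel X)"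

text \<open>The support is taken relative to the subspace topology of \<open>space M\<close>.\<close>

definition measure_support :: "'a :: topological_space measure \<Rightarrow> 'a set" where
  "measure_support M = {x \<in> space M. \<forall>U. open U \<and> x \<in> U \<longrightarrow> emeasure M (U \<inter> space M) > 0}"

text \<open>The measure is pushed forward along the inclusion of its space into the ambient space before
  it is compared with Lebesgue measure, so that every Lebesgue null Borel set \<open>N\<close> gives \<open>N \<inter> space M\<close>
  measure zero.\<close>

definition lebesgue_abs_cont :: "'a :: euclidean_space measure \<Rightarrow> bool" where
  "lebesgue_abs_cont M \<longleftrightarrow> absolutely_continuous lborel (distr M borel (\<lambda>x. x))"

definition transport_plans :: "'a measure \<Rightarrow> 'b measure \<Rightarrow> ('a \<times> 'b) measure set" where
  "transport_plans \<mu> \<nu> =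
     {\<pi>. prob_space \<pi> \<and> sets \<pi> = sets (\<mu> \<Otimes>\<^sub>M \<nu>) \<and> distr \<pi> \<mu> fst = \<mu> \<and> distr \<pi> \<nu> snd = \<nu>}"

text \<open>The total cost is possibly infinite. It is meant for nonnegative \<open>c\<close>: negative values would be
  truncated to \<open>0\<close>.\<close>

definition transport_cost :: "('a \<Rightarrow> 'b \<Rightarrow> real) \<Rightarrow> ('a \<times> 'b) measure \<Rightarrow> ennreal" where
  "transport_cost c \<pi> = (\<integral>\<^sup>+ z. ennreal (c (fst z) (snd z)) \<partial>\<pi>)"

definition optimal_plan ::
    "'a measure \<Rightarrow> 'b measure \<Rightarrow> ('a \<Rightarrow> 'b \<Rightarrow> real) \<Rightarrow> ('a \<times> 'b) measure \<Rightarrow> bool" where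
  "optimal_plan \<mu> \<nu> c \<pi> \<longleftrightarrow>
     \<pi> \<in> transport_plans \<mu> \<nu> \<and>
     (\<forall>\<pi>'\<in>transport_plans \<mu> \<nu>. transport_cost c \<pi> \<le> transport_cost c \<pi>')"

definition optimal_transport_map ::
    "'a measure \<Rightarrow> 'b measure \<Rightarrow> ('a \<Rightarrow> 'b \<Rightarrow> real) \<Rightarrow> ('a \<Rightarrow> 'b) \<Rightarrow> bool" where
  "optimal_transport_map \<mu> \<nu> c T \<longleftrightarrow>
     T \<in> measurable \<mu> \<nu> \<and> optimal_plan \<mu> \<nu> c (distr \<mu> (\<mu> \<Otimes>\<^sub>M \<nu>) (\<lambda>x. (x, T x)))"

text \<open>In the following, \<open>y\<close> and \<open>a\<close> are families indexed by \<open>{1..n}\<close>; their values at other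
  indices are irrelevant.\<close>

definition max_shift ::
    "('a \<Rightarrow> 'b \<Rightarrow> real) \<Rightarrow> nat \<Rightarrow> (nat \<Rightarrow> 'b) \<Rightarrow> (nat \<Rightarrow> real) \<Rightarrow> 'a \<Rightarrow> real" where
  "max_shift c n y a x = (MAX i\<in>{1..n}. a i - c x (y i))"

definition shift_cell ::
    "('a \<Rightarrow> 'b \<Rightarrow> real) \<Rightarrow> nat \<Rightarrow> (nat \<Rightarrow> 'b) \<Rightarrow> (nat \<Rightarrow> real) \<Rightarrow> 'a set \<Rightarrow> nat \<Rightarrow> 'a set" where
  "shift_cell c n y a A i = {x \<in> A. max_shift c n y a x = a i - c x (y i)}"

definition boundary_set :: "nat \<Rightarrow> (nat \<Rightarrow> 'a set) \<Rightarrow> 'a set" where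
  "boundary_set n C = (\<Union>i\<in>{1..n}. \<Union>j\<in>{i<..n}. C i \<inter> C j)"

definition strict_interior :: "nat \<Rightarrow> (nat \<Rightarrow> 'a set) \<Rightarrow> nat \<Rightarrow> 'a set" where
  "strict_interior n C i = C i - boundary_set n C"

definition induces_partition ::
    "'a measure \<Rightarrow> 'b measure \<Rightarrow> 'a set \<Rightarrow> nat \<Rightarrow> (nat \<Rightarrow> 'b) \<Rightarrow> (nat \<Rightarrow> 'a set) \<Rightarrow> bool" where
  "induces_partition \<mu> \<nu> A n y C \<longleftrightarrow>
     emeasure \<mu> A < \<infinity> \<and>
     (\<forall>i\<in>{1..n}. \<forall>j\<in>{1..n}. i \<noteq> j \<longrightarrow> emeasure \<mu> (C i \<inter> C j) = 0) \<and>
     (\<Sum>i\<in>{1..n}. emeasure \<mu> (C i)) = emeasure \<mu> A \<and>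
     (\<forall>i\<in>{1..n}. emeasure \<mu> (C i) = emeasure \<nu> {y i} \<and> emeasure \<nu> {y i} > 0)"

end

theory Submission
  imports Defs
begin

text \<open>
  The target measure has finitely many atoms \<open>y 1, \<dots>, y n\<close>, so the Kantorovich dual problem is a
  finite-dimensional concave maximisation: maximise
  \<open>dual a = (\<Sum>i. a i * \<nu> {y i}) - \<integral> F a d\<mu>\<close>, where \<open>F a x = max_i (a i - c x (y i))\<close>.

  Adding a constant to all shifts does not change \<open>dual\<close>, and \<open>dual\<close> becomes negative when one shift
  is far below the largest, so the continuous function \<open>dual\<close> has a maximiser \<open>a\<close>
  (\<open>dual_maximizer\<close>). Raising one shift of the maximiser by a small \<open>t\<close> cannot increase \<open>dual\<close>; as
  \<open>t\<close> tends to \<open>0\<close> this gives \<open>\<nu> {y i} \<le> \<mu> (A_i)\<close> for each cell (\<open>atom_le_cell\<close>). The cells cover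
  \<open>A\<close> and overlap in null sets only, so both sides sum to \<open>1\<close> and the inequalities are equalities
  (\<open>maximizer_cell_mass\<close>). Hence sending each cell to its atom pushes \<open>\<mu>\<close> forward to \<open>\<nu>\<close>.

  Optimality and uniqueness come from one identity (\<open>transport_cost_eq_dual_plus_gap\<close>): the cost of
  any plan is \<open>dual a\<close> plus the integral of the nonnegative function \<open>c x (y i) - a i + F a x\<close>. This
  function vanishes exactly when \<open>x\<close> lies in the cell of \<open>y i\<close>. The cell assignment makes the
  integral \<open>0\<close>, hence is optimal; any other optimal map must make it \<open>0\<close> too, hence sends almost
  every \<open>x\<close> to an atom whose cell contains \<open>x\<close>, and almost every \<open>x\<close> lies in one cell only.

  The geometry of the \<open>p\<close>-norm enters only through the fact that two cells meet in a null set. Such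
  an intersection lies in a set \<open>E\<close> on which the difference of the distances to two distinct points
  \<open>y\<close> and \<open>z\<close> is constant. By strict convexity of the norm, that difference is strictly monotone along
  every line that is parallel to \<open>y - z\<close> but does not contain \<open>y\<close> and \<open>z\<close>. So every such line meets
  \<open>E\<close> at most once, which makes \<open>E\<close> Lebesgue null; the line through \<open>y\<close> and \<open>z\<close> itself is null
  because the dimension is at least two (\<open>lp_norm_difference_level_set_null\<close>).
\<close>

section \<open>Strict convexity of the p-norm\<close>

text \<open>The graph of \<open>s powr p\<close> lies strictly above its tangent at \<open>1\<close>, because
  \<open>s powr p - p * s\<close> decreases on \<open>[0, 1]\<close> and increases afterwards.\<close>

lemma powr_gt_tangent:
  fixes p s :: real
  assumes "1 < p" "0 \<le> s" "s \<noteq> 1"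
  shows "1 + p * (s - 1) < s powr p"
proof -
  define g where "g = (\<lambda>r::real. r powr p - p * r)"
  have cont: "continuous_on {0..} g"
    unfolding g_def using assms(1) by (intro continuous_intros continuous_on_powr') auto
  have der: "DERIV g r :> p * (r powr (p - 1) - 1)" if "0 < r" for r
    unfolding g_def using that by (auto intro!: derivative_eq_intros simp: algebra_simps)
  have "g 1 < g s"
  proof (cases "s < 1")
    case True
    show ?thesis
    proof (rule DERIV_neg_imp_decreasing_open[OF True])
      fix r assume r: "s < r" "r < 1"
      hence "r powr (p - 1) < 1"
        using assms powr_less_mono2[of "p - 1" r 1] by simp
      hence "p * (r powr (p - 1) - 1) < 0" using assms by (simp add: mult_pos_neg)
      thus "\<exists>D. DERIV g r :> D \<and> D < 0" using der[of r] r assms by auto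
    qed (rule continuous_on_subset[OF cont], use assms in auto)
  next
    case False
    hence s: "1 < s" using assms by auto
    show ?thesis
    proof (rule DERIV_pos_imp_increasing_open[OF s])
      fix r assume r: "1 < r" "r < s"
      hence "1 < r powr (p - 1)"
        using assms powr_less_mono2[of "p - 1" 1 r] by simp
      hence "p * (r powr (p - 1) - 1) > 0" using assms by simp
      thus "\<exists>D. DERIV g r :> D \<and> D > 0" using der[of r] r by auto
    qed (rule continuous_on_subset[OF cont], use assms in auto)
  qed
  thus ?thesis by (simp add: g_def algebra_simps)
qed

text \<open>If \<open>s\<close> and \<open>t\<close> have different absolute values, compare \<open>\<bar>s\<bar>\<close> and \<open>\<bar>t\<bar>\<close> with the tangent at their
  weighted mean \<open>m\<close>. If \<open>t = - s\<close>, strictness comes from the cancellation in the convex combination.\<close>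

lemma abs_powr_strictly_convex:
  fixes p s t \<theta> :: real
  assumes p: "1 < p" and \<theta>: "0 < \<theta>" "\<theta> < 1" and st: "s \<noteq> t"
  shows "\<bar>(1 - \<theta>) * s + \<theta> * t\<bar> powr p < (1 - \<theta>) * \<bar>s\<bar> powr p + \<theta> * \<bar>t\<bar> powr p"
proof -
  define m where "m = (1 - \<theta>) * \<bar>s\<bar> + \<theta> * \<bar>t\<bar>"
  have le: "\<bar>(1 - \<theta>) * s + \<theta> * t\<bar> \<le> m"
    unfolding m_def using \<theta> abs_triangle_ineq[of "(1 - \<theta>) * s" "\<theta> * t"] by (simp add: abs_mult)
  show ?thesis
  proof (cases "\<bar>s\<bar> = \<bar>t\<bar>")
    case True
    hence ts: "t = - s" "s \<noteq> 0" using st by (auto simp: abs_eq_iff)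
    have "(1 - \<theta>) * s + \<theta> * t = (1 - 2 * \<theta>) * s" by (simp add: ts algebra_simps)
    moreover have "\<bar>1 - 2 * \<theta>\<bar> < 1" using \<theta> by auto
    ultimately have "\<bar>(1 - \<theta>) * s + \<theta> * t\<bar> < \<bar>s\<bar>"
      using ts by (simp add: abs_mult)
    hence "\<bar>(1 - \<theta>) * s + \<theta> * t\<bar> powr p < \<bar>s\<bar> powr p"
      using p by (intro powr_less_mono2) auto
    thus ?thesis using True by (simp add: algebra_simps)
  next
    case False
    have "0 < m"
    proof (cases "s = 0")
      case True
      thus ?thesis using st \<theta> by (simp add: m_def)
    next
      case False
      hence "0 < (1 - \<theta>) * \<bar>s\<bar>" "0 \<le> \<theta> * \<bar>t\<bar>" using \<theta> by auto
      thus ?thesis by (simp add: m_def)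
    qed
    have tan: "m powr p * (1 + p * (r / m - 1)) \<le> r powr p"
         "r \<noteq> m \<Longrightarrow> m powr p * (1 + p * (r / m - 1)) < r powr p" if "0 \<le> r" for r
    proof -
      have eq: "r powr p = m powr p * (r / m) powr p"
        using that \<open>0 < m\<close> by (simp add: powr_divide)
      show "r \<noteq> m \<Longrightarrow> m powr p * (1 + p * (r / m - 1)) < r powr p"
        unfolding eq using that \<open>0 < m\<close> powr_gt_tangent[OF p, of "r / m"] by simp
      thus "m powr p * (1 + p * (r / m - 1)) \<le> r powr p"
        using \<open>0 < m\<close> by (cases "r = m") auto
    qed
    have "\<bar>s\<bar> \<noteq> m"
      using False \<theta> by (auto simp: m_def algebra_simps)
    have "\<bar>(1 - \<theta>) * s + \<theta> * t\<bar> powr p \<le> m powr p"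
      using le p by (intro powr_mono2) auto
    also have "\<dots> = (1 - \<theta>) * (m powr p * (1 + p * (\<bar>s\<bar> / m - 1))) + \<theta> * (m powr p * (1 + p * (\<bar>t\<bar> / m - 1)))"
    proof -
      have "m / m = (1 - \<theta>) * (\<bar>s\<bar> / m) + \<theta> * (\<bar>t\<bar> / m)"
        by (subst m_def) (simp add: add_divide_distrib)
      hence "(1 - \<theta>) * (\<bar>s\<bar> / m) + \<theta> * (\<bar>t\<bar> / m) = 1" using \<open>0 < m\<close> by simp
      moreover have "(1 - \<theta>) * (m powr p * (1 + p * (\<bar>s\<bar> / m - 1))) + \<theta> * (m powr p * (1 + p * (\<bar>t\<bar> / m - 1)))
          = m powr p * (1 + p * (((1 - \<theta>) * (\<bar>s\<bar> / m) + \<theta> * (\<bar>t\<bar> / m)) - 1))"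
        by (simp add: algebra_simps)
      ultimately show ?thesis by simp
    qed
    also have "\<dots> < (1 - \<theta>) * \<bar>s\<bar> powr p + \<theta> * \<bar>t\<bar> powr p"
      using \<theta> \<open>\<bar>s\<bar> \<noteq> m\<close> tan(1)[of "\<bar>t\<bar>"] tan(2)[of "\<bar>s\<bar>"]
      by (intro add_less_le_mono mult_strict_left_mono mult_left_mono) auto
    finally show ?thesis .
  qed
qed

lemma lp_norm_nonneg: "0 \<le> lp_norm p x"
  by (simp add: lp_norm_def)

lemma lp_norm_powr:
  assumes "1 < p"
  shows "lp_norm p x powr p = (\<Sum>k\<in>UNIV. \<bar>x $ k\<bar> powr p)"
  using assms by (simp add: lp_norm_def powr_powr sum_nonneg)

lemma lp_norm_eq_0:
  assumes "1 < p"
  shows "lp_norm p x = 0 \<longleftrightarrow> x = 0"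
proof -
  have "lp_norm p x = 0 \<longleftrightarrow> (\<Sum>k\<in>UNIV. \<bar>x $ k\<bar> powr p) = 0"
    by (simp add: lp_norm_def)
  also have "\<dots> \<longleftrightarrow> (\<forall>k. x $ k = 0)"
    by (subst sum_nonneg_eq_0_iff) auto
  finally show ?thesis by (simp add: vec_eq_iff)
qed

lemma lp_norm_scaleR:
  assumes "1 < p"
  shows "lp_norm p (r *\<^sub>R x) = \<bar>r\<bar> * lp_norm p x"
  using assms
  by (simp add: lp_norm_def abs_mult powr_mult sum_distrib_left[symmetric] powr_powr sum_nonneg)

lemma continuous_on_lp_norm:
  assumes "1 < p"
  shows "continuous_on UNIV (lp_norm p :: real ^ 'a \<Rightarrow> real)"
proof -
  have "continuous_on UNIV (\<lambda>x::real ^ 'a. \<Sum>k\<in>UNIV. \<bar>x $ k\<bar> powr p)"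
    using assms
    by (intro continuous_on_sum continuous_on_powr' continuous_on_rabs continuous_on_component
        continuous_on_id continuous_on_const) auto
  thus ?thesis
    unfolding lp_norm_def using assms
    by (intro continuous_on_powr' continuous_on_const) (auto simp: sum_nonneg)
qed

text \<open>The equality case of Minkowski's inequality. After both vectors are scaled to unit norm,
  \<open>(u + v) / (\<parallel>u\<parallel> + \<parallel>v\<parallel>)\<close> is a convex combination of them, and summing the strict convexity of
  \<open>\<bar>t\<bar> powr p\<close> over the coordinates bounds its norm by \<open>1\<close>, strictly unless the two unit vectors agree.
  The hypothesis says that \<open>u\<close> and \<open>v\<close> do not lie on a common ray from the origin.\<close>

lemma lp_norm_add_less:
  assumes p: "1 < p" and ray: "lp_norm p u *\<^sub>R v \<noteq> lp_norm p v *\<^sub>R u"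
  shows "lp_norm p (u + v) < lp_norm p u + lp_norm p v"
proof -
  define a b where "a = lp_norm p u" and "b = lp_norm p v"
  have "u \<noteq> 0" "v \<noteq> 0" using ray lp_norm_eq_0[OF p, of u] lp_norm_eq_0[OF p, of v] by fastforce+
  hence ab: "0 < a" "0 < b"
    using lp_norm_eq_0[OF p, of u] lp_norm_eq_0[OF p, of v] lp_norm_nonneg[of p u] lp_norm_nonneg[of p v]
    unfolding a_def b_def by linarith+
  define \<theta> where "\<theta> = b / (a + b)"
  have \<theta>: "0 < \<theta>" "\<theta> < 1" "1 - \<theta> = a / (a + b)" using ab by (auto simp: \<theta>_def field_simps)
  have comp: "(u + v) $ k / (a + b) = (1 - \<theta>) * (u $ k / a) + \<theta> * (v $ k / b)" for k
    unfolding \<theta>(3) using ab by (simp add: \<theta>_def add_divide_distrib)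
  have unit: "(\<Sum>k\<in>UNIV. \<bar>x $ k / lp_norm p x\<bar> powr p) = 1" if "x \<noteq> 0" for x :: "real ^ 'a"
    using that lp_norm_eq_0[OF p, of x] lp_norm_nonneg[of p x]
    by (simp add: powr_divide sum_divide_distrib[symmetric] lp_norm_powr[OF p, symmetric])
  have "(\<Sum>k\<in>UNIV. \<bar>(u + v) $ k / (a + b)\<bar> powr p)
      < (\<Sum>k\<in>UNIV. (1 - \<theta>) * \<bar>u $ k / a\<bar> powr p + \<theta> * \<bar>v $ k / b\<bar> powr p)"
  proof (rule sum_strict_mono_ex1)
    show "\<forall>k\<in>UNIV. \<bar>(u + v) $ k / (a + b)\<bar> powr p
        \<le> (1 - \<theta>) * \<bar>u $ k / a\<bar> powr p + \<theta> * \<bar>v $ k / b\<bar> powr p"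
    proof
      fix k
      show "\<bar>(u + v) $ k / (a + b)\<bar> powr p
        \<le> (1 - \<theta>) * \<bar>u $ k / a\<bar> powr p + \<theta> * \<bar>v $ k / b\<bar> powr p"
        unfolding comp using abs_powr_strictly_convex[OF p \<theta>(1,2), of "u $ k / a" "v $ k / b"]
        by (cases "u $ k / a = v $ k / b") (simp_all add: distrib_right[symmetric] del: times_divide_eq_right abs_divide)
    qed
    obtain k where "a * v $ k \<noteq> b * u $ k"
      using ray by (auto simp: vec_eq_iff a_def b_def)
    hence "u $ k / a \<noteq> v $ k / b" using ab by (simp add: field_simps)
    thus "\<exists>k\<in>UNIV. \<bar>(u + v) $ k / (a + b)\<bar> powr p
        < (1 - \<theta>) * \<bar>u $ k / a\<bar> powr p + \<theta> * \<bar>v $ k / b\<bar> powr p"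
      unfolding comp using abs_powr_strictly_convex[OF p \<theta>(1,2)] by blast
  qed auto
  also have "\<dots> = 1"
    using unit[OF \<open>u \<noteq> 0\<close>] unit[OF \<open>v \<noteq> 0\<close>]
    by (simp add: sum.distrib sum_distrib_left[symmetric] a_def b_def del: abs_divide)
  finally have "lp_norm p (u + v) powr p / (a + b) powr p < 1"
    using ab p by (simp add: powr_divide sum_divide_distrib[symmetric] lp_norm_powr)
  hence "lp_norm p (u + v) powr p < (a + b) powr p" using ab by simp
  hence "\<not> a + b \<le> lp_norm p (u + v)"
    using p ab powr_mono2[of p "a + b" "lp_norm p (u + v)"] by linarith
  thus ?thesis by (simp add: a_def b_def)
qed

lemma lp_norm_strictly_convex:
  assumes p: "1 < p" and \<theta>: "0 < \<theta>" "\<theta> < 1" and ray: "lp_norm p u *\<^sub>R v \<noteq> lp_norm p v *\<^sub>R u"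
  shows "lp_norm p ((1 - \<theta>) *\<^sub>R u + \<theta> *\<^sub>R v) < (1 - \<theta>) * lp_norm p u + \<theta> * lp_norm p v"
proof -
  have "lp_norm p ((1 - \<theta>) *\<^sub>R u) *\<^sub>R \<theta> *\<^sub>R v - lp_norm p (\<theta> *\<^sub>R v) *\<^sub>R (1 - \<theta>) *\<^sub>R u
      = (\<theta> * (1 - \<theta>)) *\<^sub>R (lp_norm p u *\<^sub>R v - lp_norm p v *\<^sub>R u)"
    using \<theta> by (simp add: lp_norm_scaleR[OF p] scaleR_diff_right mult_ac)
  hence "lp_norm p ((1 - \<theta>) *\<^sub>R u) *\<^sub>R \<theta> *\<^sub>R v \<noteq> lp_norm p (\<theta> *\<^sub>R v) *\<^sub>R (1 - \<theta>) *\<^sub>R u"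
    using \<theta> ray by auto
  from lp_norm_add_less[OF p this] show ?thesis
    using \<theta> by (simp add: lp_norm_scaleR[OF p])
qed

text \<open>The increment of the norm over a step \<open>w\<close> grows along a line in direction \<open>w\<close> that misses the
  origin: \<open>q + w\<close> and \<open>q + t w\<close> both lie strictly between \<open>q\<close> and \<open>q + (t + 1) w\<close>, with complementary
  weights, so adding the two strict convexity inequalities gives the claim.\<close>

lemma lp_norm_increment_less:
  assumes p: "1 < p" and t: "0 < t" and w: "w \<noteq> 0" and q: "q \<notin> span {w}"
  shows "lp_norm p (q + w) - lp_norm p q
       < lp_norm p (q + t *\<^sub>R w + w) - lp_norm p (q + t *\<^sub>R w)"
proof -
  define v where "v = q + t *\<^sub>R w + w"
  \<comment> \<open>With \<open>v\<close> the far end of the segment from \<open>q\<close>, the step \<open>w\<close> is the fraction \<open>\<theta>\<close> of the segment.\<close>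
  define \<theta> where "\<theta> = 1 / (1 + t)"
  have \<theta>: "0 < \<theta>" "\<theta> < 1" "\<theta> * (1 + t) = 1" using t by (auto simp: \<theta>_def)
  have w_eq: "w = \<theta> *\<^sub>R (v - q)"
  proof -
    have "v - q = (1 + t) *\<^sub>R w" by (simp add: v_def algebra_simps)
    thus ?thesis using \<theta>(3) by (simp add: \<theta>_def)
  qed
  have ray: "lp_norm p q *\<^sub>R v \<noteq> lp_norm p v *\<^sub>R q"
  proof
    assume "lp_norm p q *\<^sub>R v = lp_norm p v *\<^sub>R q"
    hence *: "(lp_norm p v - lp_norm p q) *\<^sub>R q = (lp_norm p q * (1 + t)) *\<^sub>R w"
      by (simp add: v_def algebra_simps)
    show False
    proof (cases "lp_norm p v = lp_norm p q")
      case True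
      hence "lp_norm p q = 0" using * t w by auto
      hence "q = 0" using lp_norm_eq_0[OF p, of q] by blast
      thus False using q span_zero by blast
    next
      case False
      have "(lp_norm p v - lp_norm p q) *\<^sub>R q \<in> span {w}"
        unfolding * by (intro span_scale span_base) simp
      hence "(1 / (lp_norm p v - lp_norm p q)) *\<^sub>R (lp_norm p v - lp_norm p q) *\<^sub>R q \<in> span {w}"
        by (rule span_scale)
      thus False using False q by simp
    qed
  qed
  have "q + w = (1 - \<theta>) *\<^sub>R q + \<theta> *\<^sub>R v" by (subst w_eq) (simp add: algebra_simps)
  hence 1: "lp_norm p (q + w) < (1 - \<theta>) * lp_norm p q + \<theta> * lp_norm p v"
    using lp_norm_strictly_convex[OF p \<theta>(1,2) ray] by simp
  have "q + t *\<^sub>R w = v - w" by (simp add: v_def)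
  also have "\<dots> = (1 - (1 - \<theta>)) *\<^sub>R q + (1 - \<theta>) *\<^sub>R v" by (subst w_eq) (simp add: algebra_simps)
  finally have 2: "lp_norm p (q + t *\<^sub>R w) < \<theta> * lp_norm p q + (1 - \<theta>) * lp_norm p v"
    using lp_norm_strictly_convex[OF p _ _ ray, of "1 - \<theta>"] \<theta> by simp
  show ?thesis using 1 2 by (simp add: v_def algebra_simps)
qed

section \<open>Level sets of distance differences are null\<close>

text \<open>A set that meets every line in direction \<open>w\<close> at most once has pairwise disjoint translates along
  \<open>w\<close>. If the set is bounded, infinitely many of these translates fit into one ball and all have the
  same measure, which must be \<open>0\<close>. This avoids disintegrating Lebesgue measure along the direction
  \<open>w\<close>.\<close>

lemma negligible_if_translates_disjoint:
  fixes E :: "'a::euclidean_space set"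
  assumes E: "E \<in> sets borel" and disj: "\<And>x t. x \<in> E \<Longrightarrow> 0 < t \<Longrightarrow> x + t *\<^sub>R w \<notin> E"
  shows "negligible E"
proof -
  have bounded: "negligible (E \<inter> cball 0 r)" for r
  proof -
    define S where "S = E \<inter> cball 0 r"
    define f where "f = (\<lambda>m::nat. (+) ((1 / Suc m) *\<^sub>R w) ` S)"
    have S: "S \<in> lmeasurable"
      unfolding S_def using E
      by (intro bounded_set_imp_lmeasurable) (auto intro: bounded_subset[OF bounded_cball])
    have f: "f m \<in> lmeasurable" for m
      unfolding f_def using S by (rule measurable_translation)
    have f_eq: "measure lebesgue (f m) = measure lebesgue S" for m
      unfolding f_def by (rule measure_translation)
    have dis: "f i \<inter> f j = {}" if "i < j" for i j
    proof -
      { fix x x' assume x: "x \<in> S" "x' \<in> S" "(1 / Suc i) *\<^sub>R w + x = (1 / Suc j) *\<^sub>R w + x'"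
        define t :: real where "t = 1 / Suc i - 1 / Suc j"
        have "0 < t" unfolding t_def using that by (simp add: divide_strict_left_mono)
        moreover have "x + t *\<^sub>R w = x'" using x(3) by (simp add: t_def algebra_simps)
        ultimately have False using disj[of x t] x by (auto simp: S_def) }
      thus ?thesis unfolding f_def by blast
    qed
    have fam: "disjoint_family f"
      unfolding disjoint_family_on_def using dis by (metis Int_commute linorder_neqE_nat)
    have sub: "f m \<subseteq> cball 0 (r + norm w)" for m
    proof
      fix x assume "x \<in> f m"
      then obtain s where s: "s \<in> S" "x = (1 / Suc m) *\<^sub>R w + s" by (auto simp: f_def)
      have "norm x \<le> norm ((1 / Suc m) *\<^sub>R w) + norm s" unfolding s by (rule norm_triangle_ineq)
      also have "norm ((1 / Suc m) *\<^sub>R w) \<le> norm w"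
        by (simp add: divide_le_eq mult_le_cancel_left1)
      finally show "x \<in> cball 0 (r + norm w)" using s by (simp add: S_def)
    qed
    define K where "K = measure lebesgue (cball (0::'a) (r + norm w))"
    have bnd: "real N * measure lebesgue S \<le> K" for N
    proof -
      have "real N * measure lebesgue S = (\<Sum>m<N. measure lebesgue (f m))" by (simp add: f_eq)
      also have "\<dots> = measure lebesgue (\<Union>m<N. f m)"
      proof (rule measure_finite_Union[symmetric])
        show "disjoint_family_on f {..<N}"
          using fam by (rule disjoint_family_on_mono[rotated]) auto
        show "f ` {..<N} \<subseteq> sets lebesgue" using f by auto
        show "emeasure lebesgue (f i) \<noteq> \<infinity>" for i using f[of i] by (auto simp: fmeasurable_def)
      qed auto
      also have "\<dots> \<le> K"
        unfolding K_def using f sub by (intro measure_mono_fmeasurable) auto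
      finally show ?thesis .
    qed
    have "measure lebesgue S = 0"
    proof (rule ccontr)
      assume "measure lebesgue S \<noteq> 0"
      hence "0 < measure lebesgue S" using measure_nonneg[of lebesgue S] by linarith
      then obtain N :: nat where "K < real N * measure lebesgue S"
        using reals_Archimedean3 by blast
      thus False using bnd[of N] by simp
    qed
    thus ?thesis using S negligible_iff_measure by (auto simp: S_def)
  qed
  have "E = (\<Union>m::nat. E \<inter> cball 0 (real m))"
    using real_arch_simple by auto
  moreover have "negligible (\<Union>m::nat. E \<inter> cball 0 (real m))"
    by (rule negligible_countable_Union) (use bounded in auto)
  ultimately show ?thesis by simp
qed

text \<open>For \<open>k = \<plusminus>lp_norm p (y - z)\<close> the level set contains half-lines of the line through \<open>y\<close> and \<open>z\<close>.
  This line therefore has to be removed before the translation argument applies, and it is null only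
  in dimension at least two.\<close>

lemma lp_norm_difference_level_set_null:
  fixes y z :: "real ^ 'd"
  assumes d: "CARD('d) \<ge> 2" and p: "1 < p" and yz: "y \<noteq> z"
  shows "{x. lp_norm p (x - y) - lp_norm p (x - z) = k} \<in> null_sets lborel"
proof -
  define E where "E = {x. lp_norm p (x - y) - lp_norm p (x - z) = k}"
  define w where "w = y - z"
  define L where "L = (+) y ` span {w}"
  have E: "E \<in> sets borel"
  proof -
    have "continuous_on UNIV (\<lambda>x. lp_norm p (x - v))" for v :: "real ^ 'd"
      by (rule continuous_on_compose2[OF continuous_on_lp_norm[OF p]]) (auto intro: continuous_intros)
    hence "closed E" unfolding E_def
      by (intro closed_Collect_eq continuous_on_diff continuous_on_const)
    thus ?thesis by (rule borel_closed)
  qed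
  have "dim (span {w}) < DIM(real ^ 'd)"
    using dim_le_card[of "span {w}" "{w}"] d by simp
  hence L0: "negligible L" unfolding L_def
    by (intro negligible_translation negligible_lowdim)
  have "closed L" unfolding L_def by (intro closed_translation closed_span)
  hence "negligible (E - L)"
  proof (intro negligible_if_translates_disjoint[where w = w])
    fix x t assume x: "x \<in> E - L" and t: "(0::real) < t"
    have "x - y \<notin> span {w}"
    proof
      assume "x - y \<in> span {w}"
      hence "y + (x - y) \<in> L" unfolding L_def by blast
      thus False using x by simp
    qed
    from lp_norm_increment_less[OF p t _ this]
    have "lp_norm p (x - z) - lp_norm p (x - y)
        < lp_norm p (x + t *\<^sub>R w - z) - lp_norm p (x + t *\<^sub>R w - y)"
      using yz by (simp add: w_def algebra_simps)
    thus "x + t *\<^sub>R w \<notin> E - L" using x by (auto simp: E_def)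
  qed (use E in auto)
  hence "negligible ((E - L) \<union> L)" using L0 by (rule negligible_Un)
  hence "negligible E" by (rule negligible_subset) blast
  hence "E \<in> null_sets (completion lborel)" by (simp only: negligible_iff_null_sets)
  hence "E \<in> null_sets lborel" using E by (simp add: null_sets_completion_iff)
  thus ?thesis by (simp only: E_def)
qed

section \<open>Plans and maps\<close>

lemma transport_plan_fst:
  assumes "\<pi> \<in> transport_plans \<mu> \<nu>"
  shows "fst \<in> measurable \<pi> \<mu>" and "distr \<pi> \<mu> fst = \<mu>"
proof -
  have "sets \<pi> = sets (\<mu> \<Otimes>\<^sub>M \<nu>)" using assms by (simp add: transport_plans_def)
  from measurable_cong_sets[OF this refl] show "fst \<in> measurable \<pi> \<mu>" by auto
qed (use assms in \<open>simp add: transport_plans_def\<close>)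

lemma transport_plan_snd:
  assumes "\<pi> \<in> transport_plans \<mu> \<nu>"
  shows "snd \<in> measurable \<pi> \<nu>" and "distr \<pi> \<nu> snd = \<nu>"
proof -
  have "sets \<pi> = sets (\<mu> \<Otimes>\<^sub>M \<nu>)" using assms by (simp add: transport_plans_def)
  from measurable_cong_sets[OF this refl] show "snd \<in> measurable \<pi> \<nu>" by auto
qed (use assms in \<open>simp add: transport_plans_def\<close>)

lemma graph_plan_iff:
  assumes "prob_space \<mu>" and T[measurable]: "T \<in> measurable \<mu> \<nu>"
  shows "distr \<mu> (\<mu> \<Otimes>\<^sub>M \<nu>) (\<lambda>x. (x, T x)) \<in> transport_plans \<mu> \<nu> \<longleftrightarrow> distr \<mu> \<nu> T = \<nu>"
proof -
  have "prob_space (distr \<mu> (\<mu> \<Otimes>\<^sub>M \<nu>) (\<lambda>x. (x, T x)))"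
    using assms(1) by (rule prob_space.prob_space_distr) measurable
  moreover have "distr (distr \<mu> (\<mu> \<Otimes>\<^sub>M \<nu>) (\<lambda>x. (x, T x))) \<mu> fst = \<mu>"
    by (subst distr_distr) (auto simp: o_def distr_id)
  moreover have "distr (distr \<mu> (\<mu> \<Otimes>\<^sub>M \<nu>) (\<lambda>x. (x, T x))) \<nu> snd = distr \<mu> \<nu> T"
    by (subst distr_distr) (auto simp: o_def)
  ultimately show ?thesis by (simp add: transport_plans_def)
qed

section \<open>The semi-discrete problem and its dual\<close>

text \<open>What the duality argument uses of the two measures and the cost. Only \<open>ties_null\<close> is a genuine
  geometric condition: it says that the locus where two shifted costs agree is null, whatever the
  shifts are. The bounds on the cost are required on \<open>A\<close> only, since \<open>\<mu>\<close> may live on an unbounded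
  space.\<close>

locale semidiscrete_transport =
  fixes \<mu> :: "'a measure" and \<nu> :: "'b measure" and A :: "'a set"
    and c :: "'a \<Rightarrow> 'b \<Rightarrow> real" and n :: nat and y :: "nat \<Rightarrow> 'b" and K :: real
  assumes prob_source: "prob_space \<mu>" and prob_target: "prob_space \<nu>"
    and A_sets: "A \<in> sets \<mu>" and AE_A: "AE x in \<mu>. x \<in> A"
    and n_pos: "1 \<le> n" and y_inj: "inj_on y {1..n}"
    and atom_sets: "i \<in> {1..n} \<Longrightarrow> {y i} \<in> sets \<nu>"
    and atom_pos: "i \<in> {1..n} \<Longrightarrow> 0 < measure \<nu> {y i}"
    and AE_atoms: "AE z in \<nu>. z \<in> y ` {1..n}"
    and cost_measurable: "i \<in> {1..n} \<Longrightarrow> (\<lambda>x. c x (y i)) \<in> borel_measurable \<mu>"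
    and cost_nonneg: "x \<in> A \<Longrightarrow> i \<in> {1..n} \<Longrightarrow> 0 \<le> c x (y i)"
    and cost_le: "x \<in> A \<Longrightarrow> i \<in> {1..n} \<Longrightarrow> c x (y i) \<le> K"
    and ties_null: "i \<in> {1..n} \<Longrightarrow> j \<in> {1..n} \<Longrightarrow> i \<noteq> j \<Longrightarrow>
          AE x in \<mu>. c x (y i) - c x (y j) \<noteq> k"
begin

sublocale source: prob_space \<mu> by (rule prob_source)
sublocale target: prob_space \<nu> by (rule prob_target)

abbreviation F :: "(nat \<Rightarrow> real) \<Rightarrow> 'a \<Rightarrow> real" where
  "F \<equiv> max_shift c n y"

abbreviation cell :: "(nat \<Rightarrow> real) \<Rightarrow> nat \<Rightarrow> 'a set" where
  "cell a \<equiv> shift_cell c n y a A"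

definition dual :: "(nat \<Rightarrow> real) \<Rightarrow> real" where
  "dual a = (\<Sum>i=1..n. a i * measure \<nu> {y i}) - (\<integral>x. F a x \<partial>\<mu>)"

text \<open>The slack in the dual constraint \<open>a i - F a x \<le> c x (y i)\<close> at \<open>z = y i\<close>. It is set to \<open>0\<close> when \<open>z\<close>
  is not an atom, which makes it measurable and nonnegative everywhere although \<open>c\<close> is controlled at
  the atoms only.\<close>

definition gap :: "(nat \<Rightarrow> real) \<Rightarrow> 'a \<Rightarrow> 'b \<Rightarrow> real" where
  "gap a x z = (\<Sum>i=1..n. indicator {y i} z * (c x (y i) - a i + F a x))"

definition assignment :: "(nat \<Rightarrow> real) \<Rightarrow> 'a \<Rightarrow> 'b" where
  "assignment a x = y (LEAST i. i \<in> {1..n} \<and> F a x = a i - c x (y i))"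

lemma index_ne: "{1..n} \<noteq> {}"
  using n_pos by auto

lemma F_ge: "i \<in> {1..n} \<Longrightarrow> a i - c x (y i) \<le> F a x"
  by (simp add: max_shift_def)

lemma F_attained: "\<exists>i\<in>{1..n}. F a x = a i - c x (y i)"
proof -
  have "F a x \<in> (\<lambda>i. a i - c x (y i)) ` {1..n}"
    unfolding max_shift_def using index_ne by (intro Max_in) auto
  thus ?thesis by auto
qed

lemma F_le: "(\<And>i. i \<in> {1..n} \<Longrightarrow> a i - c x (y i) \<le> r) \<Longrightarrow> F a x \<le> r"
  using F_attained[of a x] by auto

lemma F_le_F_plus:
  "F a x \<le> F b x + (\<Sum>i=1..n. \<bar>a i - b i\<bar>)"
proof (rule F_le)
  fix i assume i: "i \<in> {1..n}"
  have "\<bar>a i - b i\<bar> \<le> (\<Sum>i=1..n. \<bar>a i - b i\<bar>)"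
    using i by (intro member_le_sum) auto
  thus "a i - c x (y i) \<le> F b x + (\<Sum>i=1..n. \<bar>a i - b i\<bar>)"
    using F_ge[OF i, of b x] by linarith
qed

lemma F_lipschitz: "\<bar>F a x - F b x\<bar> \<le> (\<Sum>i=1..n. \<bar>a i - b i\<bar>)"
  using F_le_F_plus[of a x b] F_le_F_plus[of b x a] by (simp add: abs_minus_commute)

lemma F_bound:
  assumes "x \<in> A"
  shows "\<bar>F a x\<bar> \<le> K + (\<Sum>i=1..n. \<bar>a i\<bar>)"
proof -
  obtain i where i: "i \<in> {1..n}" "F a x = a i - c x (y i)" using F_attained by blast
  have "\<bar>a i\<bar> \<le> (\<Sum>i=1..n. \<bar>a i\<bar>)" using i by (intro member_le_sum) auto
  thus ?thesis using i cost_nonneg[OF assms i(1)] cost_le[OF assms i(1)] by auto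
qed

lemma F_measurable [measurable]: "F a \<in> borel_measurable \<mu>"
proof -
  have "(\<lambda>x. Max ((\<lambda>i. a i - c x (y i)) ` {1..n})) \<in> borel_measurable \<mu>"
    using cost_measurable by (intro borel_measurable_Max borel_measurable_diff) auto
  thus ?thesis by (simp add: max_shift_def[abs_def])
qed

lemma F_integrable: "integrable \<mu> (F a)"
  by (rule source.integrable_const_bound[where B = "K + (\<Sum>i=1..n. \<bar>a i\<bar>)"])
    (use AE_A F_bound in auto)

lemma sum_atoms: "(\<Sum>i=1..n. measure \<nu> {y i}) = 1"
proof -
  have "y ` {1..n} = (\<Union>i\<in>{1..n}. {y i})" by auto
  hence "y ` {1..n} \<in> sets \<nu>" using atom_sets by auto
  hence "measure \<nu> (y ` {1..n}) = 1" using AE_atoms by (simp add: target.prob_eq_1)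
  also have "measure \<nu> (y ` {1..n}) = (\<Sum>z\<in>y ` {1..n}. measure \<nu> {z})"
    by (rule target.finite_measure_eq_sum_singleton) (use atom_sets in auto)
  also have "\<dots> = (\<Sum>i=1..n. measure \<nu> {y i})" using y_inj by (simp add: sum.reindex)
  finally show ?thesis by simp
qed

lemma dual_lipschitz: "\<bar>dual a - dual b\<bar> \<le> 2 * (\<Sum>i=1..n. \<bar>a i - b i\<bar>)"
proof -
  have 1: "\<bar>(\<Sum>i=1..n. a i * measure \<nu> {y i}) - (\<Sum>i=1..n. b i * measure \<nu> {y i})\<bar> \<le> (\<Sum>i=1..n. \<bar>a i - b i\<bar>)"
  proof -
    have "\<bar>\<Sum>i=1..n. (a i - b i) * measure \<nu> {y i}\<bar> \<le> (\<Sum>i=1..n. \<bar>(a i - b i) * measure \<nu> {y i}\<bar>)"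
      by (rule sum_abs)
    also have "\<dots> \<le> (\<Sum>i=1..n. \<bar>a i - b i\<bar>)"
      by (intro sum_mono) (auto simp: abs_mult intro!: mult_left_le)
    finally show ?thesis by (simp add: sum_subtractf left_diff_distrib)
  qed
  have "\<bar>(\<integral>x. F a x \<partial>\<mu>) - (\<integral>x. F b x \<partial>\<mu>)\<bar> = \<bar>\<integral>x. F a x - F b x \<partial>\<mu>\<bar>"
    using F_integrable by simp
  also have "\<dots> \<le> (\<integral>x. \<bar>F a x - F b x\<bar> \<partial>\<mu>)" by (rule integral_abs_bound)
  also have "\<dots> \<le> (\<integral>x. (\<Sum>i=1..n. \<bar>a i - b i\<bar>) \<partial>\<mu>)"
    using F_integrable F_lipschitz by (intro integral_mono) auto
  also have "\<dots> = (\<Sum>i=1..n. \<bar>a i - b i\<bar>)" by (simp add: source.prob_space)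
  finally show ?thesis using 1 unfolding dual_def by linarith
qed

lemma dual_continuous: "continuous_on S dual"
  unfolding continuous_on_def
proof
  fix a assume "a \<in> S"
  have coord: "((\<lambda>b. b i) \<longlongrightarrow> a i) (at a within S)" for i :: nat
    using continuous_on_product_coordinates[of i] continuous_on_subset[of UNIV "\<lambda>b. b i" S] \<open>a \<in> S\<close>
    by (auto simp: continuous_on_def intro: tendsto_within_subset)
  have "((\<lambda>b. dual b - dual a) \<longlongrightarrow> 0) (at a within S)"
  proof (rule Lim_null_comparison)
    show "\<forall>\<^sub>F b in at a within S. norm (dual b - dual a) \<le> 2 * (\<Sum>i=1..n. \<bar>b i - a i\<bar>)"
      using dual_lipschitz by simp
    have "((\<lambda>b. 2 * (\<Sum>i=1..n. \<bar>b i - a i\<bar>)) \<longlongrightarrow> 2 * (\<Sum>i=1..n. \<bar>a i - a i\<bar>)) (at a within S)"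
      by (intro tendsto_intros coord)
    thus "((\<lambda>b. 2 * (\<Sum>i=1..n. \<bar>b i - a i\<bar>)) \<longlongrightarrow> 0) (at a within S)" by simp
  qed
  thus "(dual \<longlongrightarrow> dual a) (at a within S)" by (rule LIM_zero_cancel)
qed

lemma dual_shift:
  assumes "\<And>i. i \<in> {1..n} \<Longrightarrow> b i = a i - m"
  shows "dual b = dual a"
proof -
  have "F b x = F a x - m" for x
  proof (rule antisym)
    show "F b x \<le> F a x - m"
    proof (rule F_le)
      fix i assume "i \<in> {1..n}"
      thus "b i - c x (y i) \<le> F a x - m" using F_ge[of i a x] assms by auto
    qed
    have "F a x \<le> F b x + m"
    proof (rule F_le)
      fix i assume "i \<in> {1..n}"
      thus "a i - c x (y i) \<le> F b x + m" using F_ge[of i b x] assms by auto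
    qed
    thus "F a x - m \<le> F b x" by simp
  qed
  hence "(\<integral>x. F b x \<partial>\<mu>) = (\<integral>x. F a x \<partial>\<mu>) - m"
    using F_integrable by (simp add: source.prob_space)
  moreover have "(\<Sum>i=1..n. b i * measure \<nu> {y i}) = (\<Sum>i=1..n. a i * measure \<nu> {y i}) - m"
    using assms sum_atoms by (simp add: left_diff_distrib sum_subtractf sum_distrib_left[symmetric])
  ultimately show ?thesis by (simp add: dual_def)
qed

text \<open>Coercivity: once the largest shift is normalised to \<open>0\<close>, the integral of \<open>F b\<close> is at least \<open>- K\<close>,
  so a single very negative shift drives \<open>dual\<close> down.\<close>

lemma dual_le:
  assumes nonpos: "\<And>i. i \<in> {1..n} \<Longrightarrow> b i \<le> 0" and m: "m \<in> {1..n}" "b m = 0" and j: "j \<in> {1..n}"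
  shows "dual b \<le> b j * measure \<nu> {y j} + K"
proof -
  have "(\<Sum>i=1..n. b i * measure \<nu> {y i}) = b j * measure \<nu> {y j} + (\<Sum>i\<in>{1..n} - {j}. b i * measure \<nu> {y i})"
    using j by (simp add: sum.remove)
  moreover have "(\<Sum>i\<in>{1..n} - {j}. b i * measure \<nu> {y i}) \<le> 0"
    using nonpos by (intro sum_nonpos) (auto intro: mult_nonpos_nonneg)
  moreover have "(\<integral>x. - K \<partial>\<mu>) \<le> (\<integral>x. F b x \<partial>\<mu>)"
  proof (rule integral_mono_AE)
    show "AE x in \<mu>. - K \<le> F b x"
      using AE_A
    proof eventually_elim
      case (elim x)
      thus ?case using F_ge[OF m(1), of b x] m cost_le[of x m] by auto
    qed
  qed (use F_integrable in auto)
  ultimately show ?thesis by (simp add: dual_def source.prob_space)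
qed

lemma dual_zero_nonneg: "0 \<le> dual (\<lambda>_. 0)"
proof -
  have "(\<integral>x. F (\<lambda>_. 0) x \<partial>\<mu>) \<le> (\<integral>x. 0 \<partial>\<mu>)"
    by (rule integral_mono_AE)
      (use AE_A F_integrable cost_nonneg in \<open>auto intro!: F_le\<close>)
  thus ?thesis by (simp add: dual_def)
qed

text \<open>By invariance under common shifts, only families with maximum \<open>0\<close> matter. Those that leave the
  compact cube \<open>[- R, 0]\<close> have a negative dual value, whereas the zero family has a nonnegative one,
  so a maximiser over the cube is a global maximiser.\<close>

lemma dual_maximizer: "\<exists>a. \<forall>b. dual b \<le> dual a"
proof -
  have K: "0 \<le> K"
  proof -
    have "measure \<mu> A = 1" using AE_A A_sets by (simp add: source.prob_eq_1)
    then obtain x where "x \<in> A" by fastforce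
    thus ?thesis using cost_nonneg[of x 1] cost_le[of x 1] n_pos by auto
  qed
  \<comment> \<open>Any upper bound of the numbers \<open>K / \<nu> {y i}\<close> works here; the sum avoids a maximum.\<close>
  define R where "R = (\<Sum>i=1..n. K / measure \<nu> {y i})"
  have R_ge: "K / measure \<nu> {y i} \<le> R" if "i \<in> {1..n}" for i
    unfolding R_def using that K by (intro member_le_sum) auto
  have "0 \<le> R" unfolding R_def using K by (intro sum_nonneg) auto
  define S where "S = (UNIV \<rightarrow>\<^sub>E {- R..0} :: (nat \<Rightarrow> real) set)"
  have "compact S"
    unfolding S_def compactin_euclidean_iff[symmetric] euclidean_product_topology[symmetric]
    by (subst compactin_PiE) (simp add: compactin_euclidean_iff)
  moreover have zero: "(\<lambda>_. 0) \<in> S" using \<open>0 \<le> R\<close> by (auto simp: S_def)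
  ultimately obtain a where a: "a \<in> S" "\<And>b. b \<in> S \<Longrightarrow> dual b \<le> dual a"
    using continuous_attains_sup[of S dual] dual_continuous by blast
  have "dual b \<le> dual a" for b
  proof -
    \<comment> \<open>Normalise so that the largest shift is \<open>0\<close>; \<open>dual\<close> ignores the indices outside \<open>1..n\<close>, which are set to \<open>0\<close> to stay in the cube.\<close>
    define m where "m = Max (b ` {1..n})"
    define b' where "b' = (\<lambda>i. if i \<in> {1..n} then b i - m else 0)"
    have "m \<in> b ` {1..n}" unfolding m_def using index_ne by (intro Max_in) auto
    then obtain k where k: "k \<in> {1..n}" "b' k = 0" by (auto simp: b'_def)
    have nonpos: "b' i \<le> 0" for i unfolding b'_def m_def by auto
    have "dual b' \<le> dual a"
    proof (cases "b' \<in> S")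
      case False
      then obtain j where j: "\<not> - R \<le> b' j" using nonpos by (auto simp: S_def PiE_iff)
      hence j': "j \<in> {1..n}" using \<open>0 \<le> R\<close> by (auto simp: b'_def split: if_splits)
      have "b' j < - (K / measure \<nu> {y j})" using j R_ge[OF j'] by simp
      hence "b' j * measure \<nu> {y j} + K < 0" using atom_pos[OF j'] by (simp add: field_simps)
      hence "dual b' < 0" using dual_le[of b' k j, OF nonpos k j'] by simp
      thus ?thesis using dual_zero_nonneg a(2)[OF zero] by simp
    qed (rule a(2))
    moreover have "dual b' = dual b" by (rule dual_shift) (simp add: b'_def)
    ultimately show ?thesis by simp
  qed
  thus ?thesis by blast
qed

section \<open>Cell masses at a dual maximiser\<close>

lemma cell_sets [measurable]: "i \<in> {1..n} \<Longrightarrow> cell a i \<in> sets \<mu>"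
proof -
  assume i: "i \<in> {1..n}"
  note [measurable] = cost_measurable[OF i] A_sets
  have "cell a i = A \<inter> {x \<in> space \<mu>. F a x = a i - c x (y i)}"
    using sets.sets_into_space[OF A_sets] by (auto simp: shift_cell_def)
  also have "\<dots> \<in> sets \<mu>" by measurable
  finally show ?thesis .
qed

text \<open>A point of two cells \<open>i\<close> and \<open>j\<close> satisfies \<open>c x (y i) - c x (y j) = a i - a j\<close>, which is a tie.\<close>

lemma AE_unique_cell:
  "AE x in \<mu>. \<exists>i. {j\<in>{1..n}. x \<in> cell a j} = {i}"
proof -
  have "AE x in \<mu>. \<forall>i\<in>{1..n}. \<forall>j\<in>{1..n}. i \<noteq> j \<longrightarrow> c x (y i) - c x (y j) \<noteq> a i - a j"
    by (intro AE_finite_allI AE_impI finite_atLeastAtMost) (rule ties_null)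
  thus ?thesis using AE_A
  proof eventually_elim
    case (elim x)
    obtain i where i: "i \<in> {1..n}" "F a x = a i - c x (y i)" using F_attained by blast
    have uniq: "j = i" if j: "j \<in> {1..n}" "x \<in> cell a j" for j
    proof -
      have "F a x = a j - c x (y j)" using j by (simp add: shift_cell_def)
      hence "c x (y i) - c x (y j) = a i - a j" using i by simp
      thus ?thesis using elim(1)[rule_format, OF i(1) j(1)] by metis
    qed
    have "x \<in> cell a i" using i(2) elim(2) by (simp add: shift_cell_def)
    have "{j\<in>{1..n}. x \<in> cell a j} = {i}"
    proof (intro equalityI subsetI)
      fix j assume "j \<in> {j\<in>{1..n}. x \<in> cell a j}"
      hence "j = i" by (intro uniq) simp_all
      thus "j \<in> {i}" by simp
    qed (use i(1) \<open>x \<in> cell a i\<close> in simp)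
    thus ?case by (rule exI)
  qed
qed

lemma cell_index_unique:
  assumes "\<exists>k. {j\<in>{1..n}. x \<in> cell a j} = {k}"
    and "i \<in> {1..n}" "x \<in> cell a i" "j \<in> {1..n}" "x \<in> cell a j"
  shows "i = j"
proof -
  obtain k where k: "{j\<in>{1..n}. x \<in> cell a j} = {k}" using assms(1) by blast
  have "i \<in> {k}" "j \<in> {k}" unfolding k[symmetric] using assms(2-5) by simp_all
  thus ?thesis by simp
qed

lemma sum_cell_indicator:
  assumes "{j\<in>{1..n}. x \<in> cell a j} = {i}"
  shows "(\<Sum>j=1..n. g j * indicator (cell a j) x) = (g i :: real)"
proof -
  have "(\<Sum>j=1..n. g j * indicator (cell a j) x) = (\<Sum>j=1..n. if x \<in> cell a j then g j else 0)"
    by (intro sum.cong) (auto simp: indicator_def)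
  also have "\<dots> = (\<Sum>j\<in>{j\<in>{1..n}. x \<in> cell a j}. g j)"
    by (rule sum.inter_filter[symmetric]) simp
  finally show ?thesis unfolding assms by simp
qed

lemma sum_cells: "(\<Sum>i=1..n. measure \<mu> (cell a i)) = 1"
proof -
  have "(\<Sum>i=1..n. measure \<mu> (cell a i)) = (\<integral>x. (\<Sum>i=1..n. 1 * indicator (cell a i) x) \<partial>\<mu>)"
    by (subst Bochner_Integration.integral_sum)
      (simp_all add: source.emeasure_finite less_top[symmetric] Int_absorb2 sets.sets_into_space)
  also have "\<dots> = (\<integral>x. 1 \<partial>\<mu>)"
  proof (rule integral_cong_AE)
    show "AE x in \<mu>. (\<Sum>i=1..n. 1 * indicator (cell a i) x) = (1::real)"
      using AE_unique_cell[of a]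
    proof eventually_elim
      case (elim x)
      then obtain i where "{j\<in>{1..n}. x \<in> cell a j} = {i}" by blast
      thus ?case by (rule sum_cell_indicator)
    qed
  qed measurable
  finally show ?thesis by (simp add: source.prob_space)
qed

text \<open>First-order condition in finite-difference form. Raising the \<open>i\<close>-th shift by \<open>t\<close> raises the linear
  part of \<open>dual\<close> by \<open>t * \<nu> {y i}\<close>; it raises \<open>F a\<close> by at most \<open>t\<close>, and only at points where the \<open>i\<close>-th
  term comes within \<open>t\<close> of the maximum.\<close>

lemma atom_le_enlarged_cell:
  assumes a: "\<And>b. dual b \<le> dual a" and i: "i \<in> {1..n}" and t: "0 < t"
  shows "measure \<nu> {y i} \<le> measure \<mu> {x \<in> space \<mu>. F a x \<le> a i + t - c x (y i)}"
proof -
  define b where "b = a(i := a i + t)"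
  define S where "S = {x \<in> space \<mu>. F a x \<le> a i + t - c x (y i)}"
  note [measurable] = cost_measurable[OF i]
  have S[measurable]: "S \<in> sets \<mu>" unfolding S_def by measurable
  have Fb: "F b x \<le> F a x + t * indicator S x" if "x \<in> space \<mu>" for x
  proof (rule F_le)
    fix j assume j: "j \<in> {1..n}"
    show "b j - c x (y j) \<le> F a x + t * indicator S x"
      using that F_ge[OF j, of a x] t by (auto simp: b_def S_def indicator_def)
  qed
  have "(\<integral>x. F b x \<partial>\<mu>) \<le> (\<integral>x. F a x + t * indicator S x \<partial>\<mu>)"
    using F_integrable Fb by (intro integral_mono) (auto simp: source.emeasure_finite less_top[symmetric])
  also have "\<dots> = (\<integral>x. F a x \<partial>\<mu>) + t * measure \<mu> S"
    using F_integrable by (subst Bochner_Integration.integral_add) (auto simp: source.emeasure_finite less_top[symmetric])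
  finally have 1: "(\<integral>x. F b x \<partial>\<mu>) \<le> (\<integral>x. F a x \<partial>\<mu>) + t * measure \<mu> S" .
  have "(\<Sum>j=1..n. b j * measure \<nu> {y j}) = (\<Sum>j=1..n. a j * measure \<nu> {y j}) + t * measure \<nu> {y i}"
  proof -
    have "(\<Sum>j=1..n. b j * measure \<nu> {y j})
        = (\<Sum>j=1..n. a j * measure \<nu> {y j} + (if j = i then t * measure \<nu> {y i} else 0))"
      by (intro sum.cong) (auto simp: b_def algebra_simps)
    thus ?thesis using i by (simp add: sum.distrib)
  qed
  hence "t * measure \<nu> {y i} \<le> t * measure \<mu> S"
    using 1 a[of b] by (simp add: dual_def)
  thus ?thesis using t by (simp add: S_def)
qed

lemma atom_le_cell:
  assumes a: "\<And>b. dual b \<le> dual a" and i: "i \<in> {1..n}"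
  shows "measure \<nu> {y i} \<le> measure \<mu> (cell a i)"
proof -
  define S where "S = (\<lambda>k::nat. {x \<in> space \<mu>. F a x \<le> a i + 1 / Suc k - c x (y i)})"
  note [measurable] = cost_measurable[OF i]
  have S[measurable]: "S k \<in> sets \<mu>" for k unfolding S_def by measurable
  have "decseq S"
  proof (rule decseq_SucI)
    fix k
    have "1 / real (Suc (Suc k)) \<le> 1 / real (Suc k)" by (intro divide_left_mono) auto
    thus "S (Suc k) \<subseteq> S k" unfolding S_def by fastforce
  qed
  hence "(\<lambda>k. measure \<mu> (S k)) \<longlonglongrightarrow> measure \<mu> (\<Inter>k. S k)"
    using S by (intro source.finite_Lim_measure_decseq) auto
  moreover have "measure \<nu> {y i} \<le> measure \<mu> (S k)" for k
    unfolding S_def by (rule atom_le_enlarged_cell[OF a i]) simp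
  ultimately have "measure \<nu> {y i} \<le> measure \<mu> (\<Inter>k. S k)"
    by (intro LIMSEQ_le_const) auto
  also have "\<dots> \<le> measure \<mu> (cell a i)"
  proof (rule source.finite_measure_mono_AE)
    show "AE x in \<mu>. x \<in> (\<Inter>k. S k) \<longrightarrow> x \<in> cell a i"
      using AE_A
    proof eventually_elim
      case (elim x)
      show ?case
      proof
        assume x: "x \<in> (\<Inter>k. S k)"
        have "F a x \<le> a i - c x (y i)"
        proof (rule field_le_epsilon)
          fix e :: real assume "0 < e"
          then obtain k where "1 / real (Suc k) < e" using nat_approx_posE by metis
          moreover have "F a x \<le> a i + 1 / Suc k - c x (y i)" using x by (auto simp: S_def)
          ultimately show "F a x \<le> a i - c x (y i) + e" by linarith
        qed
        thus "x \<in> cell a i" using F_ge[OF i, of a x] elim by (auto simp: shift_cell_def)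
      qed
    qed
  qed (rule cell_sets[OF i])
  finally show ?thesis .
qed

text \<open>The inequalities of the previous lemma have the same total \<open>1\<close> on both sides, so none is strict.\<close>

lemma maximizer_cell_mass:
  assumes a: "\<And>b. dual b \<le> dual a" and i: "i \<in> {1..n}"
  shows "measure \<mu> (cell a i) = measure \<nu> {y i}"
proof -
  have "(\<Sum>j=1..n. measure \<mu> (cell a j) - measure \<nu> {y j}) = 0"
    using sum_cells[of a] sum_atoms by (simp add: sum_subtractf)
  moreover have "\<forall>j\<in>{1..n}. 0 \<le> measure \<mu> (cell a j) - measure \<nu> {y j}"
    using atom_le_cell[OF a] by simp
  ultimately have "\<forall>j\<in>{1..n}. measure \<mu> (cell a j) - measure \<nu> {y j} = 0"
    using sum_nonneg_eq_0_iff[of "{1..n}" "\<lambda>j. measure \<mu> (cell a j) - measure \<nu> {y j}"] by blast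
  thus ?thesis using i by simp
qed

section \<open>Duality, optimality and uniqueness\<close>

lemma gap_nonneg: "0 \<le> gap a x z"
  unfolding gap_def
proof (intro sum_nonneg mult_nonneg_nonneg)
  fix i assume "i \<in> {1..n}"
  from F_ge[OF this, of a x] show "0 \<le> c x (y i) - a i + F a x" by linarith
qed (simp add: indicator_def)

lemma sum_atom_indicator:
  assumes "i \<in> {1..n}"
  shows "(\<Sum>j=1..n. indicator {y j} (y i) * g j) = (g i :: real)"
proof -
  have "(\<Sum>j=1..n. indicator {y j} (y i) * g j) = (\<Sum>j=1..n. if j = i then g j else 0)"
    using assms by (intro sum.cong) (auto simp: indicator_def inj_on_eq_iff[OF y_inj])
  thus ?thesis using assms by simp
qed

lemma gap_at_atom: "i \<in> {1..n} \<Longrightarrow> gap a x (y i) = c x (y i) - a i + F a x"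
  unfolding gap_def by (rule sum_atom_indicator)

lemma gap_eq_0_iff: "x \<in> A \<Longrightarrow> i \<in> {1..n} \<Longrightarrow> gap a x (y i) = 0 \<longleftrightarrow> x \<in> cell a i"
  by (auto simp: gap_at_atom shift_cell_def)

lemma gap_measurable:
  "(\<lambda>w. gap a (fst w) (snd w)) \<in> borel_measurable (\<mu> \<Otimes>\<^sub>M \<nu>)"
  unfolding gap_def
proof (intro borel_measurable_sum borel_measurable_times borel_measurable_add borel_measurable_diff)
  fix i assume i: "i \<in> {1..n}"
  note [measurable] = cost_measurable[OF i] atom_sets[OF i]
  show "(\<lambda>w. indicator {y i} (snd w)) \<in> borel_measurable (\<mu> \<Otimes>\<^sub>M \<nu>)" by measurable
  show "(\<lambda>w. c (fst w) (y i)) \<in> borel_measurable (\<mu> \<Otimes>\<^sub>M \<nu>)"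
    using measurable_compose[OF measurable_fst cost_measurable[OF i]] .
  show "(\<lambda>w. F a (fst w)) \<in> borel_measurable (\<mu> \<Otimes>\<^sub>M \<nu>)" by measurable
qed simp

lemma gap_bound:
  assumes "x \<in> A"
  shows "\<bar>gap a x z\<bar> \<le> real n * (2 * (K + (\<Sum>i=1..n. \<bar>a i\<bar>)))"
proof -
  have "\<bar>indicator {y i} z * (c x (y i) - a i + F a x)\<bar> \<le> 2 * (K + (\<Sum>i=1..n. \<bar>a i\<bar>))"
    if i: "i \<in> {1..n}" for i
  proof -
    have "\<bar>a i\<bar> \<le> (\<Sum>i=1..n. \<bar>a i\<bar>)" using i by (intro member_le_sum) auto
    moreover have "\<bar>c x (y i)\<bar> \<le> K" using cost_nonneg[OF assms i] cost_le[OF assms i] by simp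
    moreover have "\<bar>c x (y i) - a i + F a x\<bar> \<le> \<bar>c x (y i)\<bar> + \<bar>a i\<bar> + \<bar>F a x\<bar>" by linarith
    ultimately have "\<bar>c x (y i) - a i + F a x\<bar> \<le> 2 * (K + (\<Sum>i=1..n. \<bar>a i\<bar>))"
      using F_bound[OF assms, of a] by (simp only: distrib_left mult_2)
    thus ?thesis by (auto simp: indicator_def)
  qed
  hence "(\<Sum>i=1..n. \<bar>indicator {y i} z * (c x (y i) - a i + F a x)\<bar>)
      \<le> (\<Sum>i=1..n. 2 * (K + (\<Sum>i=1..n. \<bar>a i\<bar>)))" by (intro sum_mono)
  moreover have "\<bar>gap a x z\<bar> \<le> (\<Sum>i=1..n. \<bar>indicator {y i} z * (c x (y i) - a i + F a x)\<bar>)"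
    unfolding gap_def by (rule sum_abs)
  ultimately show ?thesis by simp
qed

lemma atom_potential_integral:
  "integrable \<nu> (\<lambda>z. \<Sum>i=1..n. indicator {y i} z * a i)"
  "(\<integral>z. (\<Sum>i=1..n. indicator {y i} z * a i) \<partial>\<nu>) = (\<Sum>i=1..n. a i * measure \<nu> {y i})"
proof -
  have int: "integrable \<nu> (\<lambda>z. indicator {y i} z * a i)" if "i \<in> {1..n}" for i
    using atom_sets[OF that]
    by (intro integrable_mult_left) (auto simp: target.emeasure_finite less_top[symmetric])
  thus "integrable \<nu> (\<lambda>z. \<Sum>i=1..n. indicator {y i} z * a i)"
    by (intro Bochner_Integration.integrable_sum)
  have "(\<integral>z. indicator {y i} z * a i \<partial>\<nu>) = a i * measure \<nu> {y i}" if "i \<in> {1..n}" for i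
    using atom_sets[OF that] sets.sets_into_space[OF atom_sets[OF that]]
    by (simp add: Int_absorb1 mult.commute)
  hence "(\<Sum>i=1..n. \<integral>z. indicator {y i} z * a i \<partial>\<nu>) = (\<Sum>i=1..n. a i * measure \<nu> {y i})"
    by (rule sum.cong[OF refl])
  thus "(\<integral>z. (\<Sum>i=1..n. indicator {y i} z * a i) \<partial>\<nu>) = (\<Sum>i=1..n. a i * measure \<nu> {y i})"
    by (simp only: Bochner_Integration.integral_sum[OF int])
qed

text \<open>Almost surely under a plan, \<open>c x z\<close> is the sum of the gap, the shift of the atom \<open>z\<close>, and \<open>- F a x\<close>.
  The last two terms depend on one coordinate each, so their integrals are determined by the marginals
  and add up to \<open>dual a\<close> for every plan. The nonnegativity of the real sum matters because \<open>ennreal\<close>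
  truncates negative numbers to \<open>0\<close>.\<close>

lemma transport_cost_eq_dual_plus_gap:
  assumes \<pi>: "\<pi> \<in> transport_plans \<mu> \<nu>"
  shows "integrable \<pi> (\<lambda>w. gap a (fst w) (snd w))"
    and "transport_cost c \<pi> = ennreal (dual a + (\<integral>w. gap a (fst w) (snd w) \<partial>\<pi>))"
    and "0 \<le> dual a + (\<integral>w. gap a (fst w) (snd w) \<partial>\<pi>)"
proof -
  interpret \<pi>: prob_space \<pi> using \<pi> by (simp add: transport_plans_def)
  note fst = transport_plan_fst[OF \<pi>] and snd = transport_plan_snd[OF \<pi>]
  have fst_A: "AE w in \<pi>. fst w \<in> A"
    using AE_distrD[OF fst(1), of "\<lambda>x. x \<in> A"] AE_A unfolding fst(2) by blast
  have snd_atom: "AE w in \<pi>. snd w \<in> y ` {1..n}"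
    using AE_distrD[OF snd(1), of "\<lambda>z. z \<in> y ` {1..n}"] AE_atoms unfolding snd(2) by blast
  have "sets \<pi> = sets (\<mu> \<Otimes>\<^sub>M \<nu>)" using \<pi> by (simp add: transport_plans_def)
  hence gap_meas: "(\<lambda>w. gap a (fst w) (snd w)) \<in> borel_measurable \<pi>"
    using gap_measurable measurable_cong_sets by blast
  show gap_int: "integrable \<pi> (\<lambda>w. gap a (fst w) (snd w))"
    by (rule \<pi>.integrable_const_bound[OF _ gap_meas]) (use fst_A in eventually_elim, use gap_bound in simp)
  define \<alpha> where "\<alpha> = (\<lambda>z. \<Sum>i=1..n. indicator {y i} z * a i)"
  have \<alpha>_int: "integrable \<pi> (\<lambda>w. \<alpha> (snd w))" "(\<integral>w. \<alpha> (snd w) \<partial>\<pi>) = (\<Sum>i=1..n. a i * measure \<nu> {y i})"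
    using integrable_distr[OF snd(1), of \<alpha>] integral_distr[OF snd(1), of \<alpha>]
      atom_potential_integral[of a] borel_measurable_integrable
    unfolding snd(2) \<alpha>_def by auto
  have F_int: "integrable \<pi> (\<lambda>w. F a (fst w))" "(\<integral>w. F a (fst w) \<partial>\<pi>) = (\<integral>x. F a x \<partial>\<mu>)"
    using integrable_distr[OF fst(1), of "F a"] integral_distr[OF fst(1), of "F a"] F_integrable[of a]
    unfolding fst(2) by auto
  define h where "h = (\<lambda>w. gap a (fst w) (snd w) + \<alpha> (snd w) - F a (fst w))"
  have h_int: "integrable \<pi> h" "(\<integral>w. h w \<partial>\<pi>) = dual a + (\<integral>w. gap a (fst w) (snd w) \<partial>\<pi>)"
    unfolding h_def using gap_int \<alpha>_int F_int by (auto simp: dual_def)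
  have cost: "AE w in \<pi>. c (fst w) (snd w) = h w \<and> 0 \<le> h w"
    using fst_A snd_atom
  proof eventually_elim
    case (elim w)
    then obtain i where i: "i \<in> {1..n}" "snd w = y i" by blast
    have "h w = c (fst w) (y i)"
      unfolding h_def \<alpha>_def i(2) by (simp only: gap_at_atom[OF i(1)] sum_atom_indicator[OF i(1)])
    thus ?case using i cost_nonneg[OF elim(1) i(1)] by simp
  qed
  have "transport_cost c \<pi> = (\<integral>\<^sup>+ w. ennreal (h w) \<partial>\<pi>)"
    unfolding transport_cost_def by (rule nn_integral_cong_AE) (use cost in eventually_elim, simp)
  also have "\<dots> = ennreal (\<integral>w. h w \<partial>\<pi>)"
    by (rule nn_integral_eq_integral[OF h_int(1)]) (use cost in eventually_elim, simp)
  finally show "transport_cost c \<pi> = ennreal (dual a + (\<integral>w. gap a (fst w) (snd w) \<partial>\<pi>))"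
    by (simp only: h_int(2))
  have "0 \<le> (\<integral>w. h w \<partial>\<pi>)" by (rule integral_nonneg_AE) (use cost in eventually_elim, simp)
  thus "0 \<le> dual a + (\<integral>w. gap a (fst w) (snd w) \<partial>\<pi>)" by (simp only: h_int(2))
qed

lemma assignment_in_cell:
  "\<exists>i\<in>{1..n}. assignment a x = y i \<and> F a x = a i - c x (y i)"
proof -
  define i where "i = (LEAST i. i \<in> {1..n} \<and> F a x = a i - c x (y i))"
  have "i \<in> {1..n} \<and> F a x = a i - c x (y i)"
    unfolding i_def by (rule LeastI_ex) (use F_attained in blast)
  thus ?thesis by (auto simp: assignment_def i_def)
qed

lemma assignment_measurable: "assignment a \<in> measurable \<mu> \<nu>"
proof -
  define idx where "idx = (\<lambda>x. LEAST i. i \<in> {1..n} \<and> F a x = a i - c x (y i))"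
  have range: "idx x \<in> {1..n}" for x
    using LeastI_ex[of "\<lambda>i. i \<in> {1..n} \<and> F a x = a i - c x (y i)"] F_attained[of a x]
    unfolding idx_def by blast
  have "Measurable.pred \<mu> (\<lambda>x. i \<in> {1..n} \<and> F a x = a i - c x (y i))" for i
  proof (cases "i \<in> {1..n}")
    case True
    note [measurable] = cost_measurable[OF True]
    have "Measurable.pred \<mu> (\<lambda>x. F a x = a i - c x (y i))" by measurable
    thus ?thesis by (simp only: True simp_thms)
  next
    case False
    show ?thesis by (simp only: False simp_thms) measurable
  qed
  hence "idx \<in> measurable \<mu> (count_space UNIV)"
    unfolding idx_def by (rule measurable_Least)
  hence "idx \<in> measurable \<mu> (restrict_space (count_space UNIV) {1..n})"
    using range by (intro measurable_restrict_space2) auto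
  hence "idx \<in> measurable \<mu> (count_space {1..n})"
    by (simp add: restrict_count_space)
  moreover have "y \<in> measurable (count_space {1..n}) \<nu>"
    using sets.sets_into_space[OF atom_sets] by auto
  ultimately have "(\<lambda>x. y (idx x)) \<in> measurable \<mu> \<nu>" by (rule measurable_compose)
  thus ?thesis by (simp add: assignment_def[abs_def] idx_def)
qed

lemma AE_assignment:
  "AE x in \<mu>. \<forall>i\<in>{1..n}. x \<in> cell a i \<longrightarrow> assignment a x = y i"
  using AE_unique_cell[of a] AE_A
proof eventually_elim
  case (elim x)
  obtain j where j: "j \<in> {1..n}" "assignment a x = y j" "F a x = a j - c x (y j)"
    using assignment_in_cell by blast
  hence "x \<in> cell a j" using elim(2) by (simp add: shift_cell_def)
  show ?case
  proof (intro ballI impI)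
    fix i assume "i \<in> {1..n}" "x \<in> cell a i"
    hence "i = j" using cell_index_unique[OF elim(1)] j(1) \<open>x \<in> cell a j\<close> by simp
    thus "assignment a x = y i" using j(2) by simp
  qed
qed

text \<open>Both measures of a set \<open>B\<close> equal the total mass of those cells, respectively atoms, whose point
  \<open>y i\<close> lies in \<open>B\<close>.\<close>

lemma assignment_pushforward:
  assumes a: "\<And>b. dual b \<le> dual a"
  shows "distr \<mu> \<nu> (assignment a) = \<nu>"
proof (rule measure_eqI)
  fix B assume "B \<in> sets (distr \<mu> \<nu> (assignment a))"
  hence B[measurable]: "B \<in> sets \<nu>" by simp
  note [measurable] = assignment_measurable[of a]
  have "measure \<mu> (assignment a -` B \<inter> space \<mu>) = (\<integral>x. indicator (assignment a -` B \<inter> space \<mu>) x \<partial>\<mu>)"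
    by simp
  also have "\<dots> = (\<integral>x. indicator B (assignment a x) \<partial>\<mu>)"
    by (rule Bochner_Integration.integral_cong) (simp_all add: indicator_def)
  also have "\<dots> = (\<integral>x. (\<Sum>i=1..n. indicator B (y i) * indicator (cell a i) x) \<partial>\<mu>)"
  proof (rule integral_cong_AE)
    show "AE x in \<mu>. indicator B (assignment a x) = (\<Sum>i=1..n. indicator B (y i) * indicator (cell a i) x :: real)"
      using AE_unique_cell[of a] AE_assignment[of a]
    proof eventually_elim
      case (elim x)
      then obtain i where i: "{j\<in>{1..n}. x \<in> cell a j} = {i}" by blast
      hence "assignment a x = y i" using elim(2) by blast
      thus ?case by (simp only: sum_cell_indicator[OF i])
    qed
    show "(\<lambda>x. indicator B (assignment a x) :: real) \<in> borel_measurable \<mu>" by measurable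
    show "(\<lambda>x. \<Sum>i=1..n. indicator B (y i) * indicator (cell a i) x :: real) \<in> borel_measurable \<mu>"
      by (intro borel_measurable_sum borel_measurable_times borel_measurable_const
          borel_measurable_indicator cell_sets)
  qed
  also have "\<dots> = (\<Sum>i=1..n. indicator B (y i) * measure \<mu> (cell a i))"
    by (subst Bochner_Integration.integral_sum) (auto simp: source.emeasure_finite less_top[symmetric])
  also have "\<dots> = (\<Sum>i=1..n. indicator B (y i) * measure \<nu> {y i})"
    using maximizer_cell_mass[OF a] by simp
  also have "\<dots> = (\<integral>z. (\<Sum>i=1..n. indicator {y i} z * indicator B (y i)) \<partial>\<nu>)"
    by (rule atom_potential_integral(2)[symmetric])
  also have "\<dots> = (\<integral>z. indicator B z \<partial>\<nu>)"
  proof (rule integral_cong_AE)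
    show "AE z in \<nu>. (\<Sum>i=1..n. indicator {y i} z * indicator B (y i)) = (indicator B z :: real)"
      using AE_atoms
    proof eventually_elim
      case (elim z)
      then obtain i where i: "i \<in> {1..n}" "z = y i" by blast
      show ?case unfolding i(2) by (rule sum_atom_indicator[OF i(1)])
    qed
    show "(\<lambda>z. \<Sum>i=1..n. indicator {y i} z * indicator B (y i) :: real) \<in> borel_measurable \<nu>"
      by (rule borel_measurable_integrable[OF atom_potential_integral(1)])
  qed (rule borel_measurable_indicator[OF B])
  also have "\<dots> = measure \<nu> B" using sets.sets_into_space[OF B] by (simp add: Int_absorb2)
  finally show "emeasure (distr \<mu> \<nu> (assignment a)) B = emeasure \<nu> B"
    by (simp add: emeasure_distr source.emeasure_eq_measure target.emeasure_eq_measure)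
qed simp

text \<open>Complementary slackness: a transport map with zero gap attains the lower bound \<open>dual a\<close>, and every
  map that attains the bound has zero gap.\<close>

lemma graph_gap_zero_imp_optimal:
  assumes T[measurable]: "T \<in> measurable \<mu> \<nu>" and push: "distr \<mu> \<nu> T = \<nu>"
    and gap: "AE x in \<mu>. gap a x (T x) = 0"
  shows "optimal_transport_map \<mu> \<nu> c T"
    and "optimal_transport_map \<mu> \<nu> c T' \<Longrightarrow> AE x in \<mu>. gap a x (T' x) = 0"
proof -
  define graph where "graph = (\<lambda>S. distr \<mu> (\<mu> \<Otimes>\<^sub>M \<nu>) (\<lambda>x. (x, S x)))"
  have gap_graph: "(\<integral>w. gap a (fst w) (snd w) \<partial>graph S) = (\<integral>x. gap a x (S x) \<partial>\<mu>)"
    if [measurable]: "S \<in> measurable \<mu> \<nu>" for S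
    unfolding graph_def by (subst integral_distr[OF _ gap_measurable]) auto
  have plan: "graph T \<in> transport_plans \<mu> \<nu>"
    using graph_plan_iff[OF prob_source T] push by (simp add: graph_def)
  have "(\<integral>x. gap a x (T x) \<partial>\<mu>) = 0"
    by (rule integral_eq_zero_AE) (rule gap)
  hence cost: "transport_cost c (graph T) = ennreal (dual a)" and pos: "0 \<le> dual a"
    using transport_cost_eq_dual_plus_gap(2,3)[OF plan, of a] gap_graph[OF T] by auto
  have "transport_cost c (graph T) \<le> transport_cost c \<pi>'" if "\<pi>' \<in> transport_plans \<mu> \<nu>" for \<pi>'
    unfolding cost transport_cost_eq_dual_plus_gap(2)[OF that, of a]
    using gap_nonneg by (intro ennreal_leI) simp
  thus "optimal_transport_map \<mu> \<nu> c T"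
    using plan T by (simp add: optimal_transport_map_def optimal_plan_def graph_def)
  assume opt: "optimal_transport_map \<mu> \<nu> c T'"
  hence T'[measurable]: "T' \<in> measurable \<mu> \<nu>" and plan': "graph T' \<in> transport_plans \<mu> \<nu>"
    and le: "transport_cost c (graph T') \<le> transport_cost c (graph T)"
    using plan by (auto simp: optimal_transport_map_def optimal_plan_def graph_def)
  note decomp = transport_cost_eq_dual_plus_gap[OF plan', of a]
  have "dual a + (\<integral>w. gap a (fst w) (snd w) \<partial>graph T') \<le> dual a"
    using le pos unfolding cost decomp(2) by (simp add: ennreal_le_iff)
  moreover have "0 \<le> (\<integral>w. gap a (fst w) (snd w) \<partial>graph T')"
    using gap_nonneg by (intro Bochner_Integration.integral_nonneg) auto
  ultimately have "(\<integral>w. gap a (fst w) (snd w) \<partial>graph T') = 0" by simp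
  hence "AE w in graph T'. gap a (fst w) (snd w) = 0"
    using integral_nonneg_eq_0_iff_AE[OF decomp(1)] gap_nonneg by simp
  moreover have "(\<lambda>x. (x, T' x)) \<in> measurable \<mu> (\<mu> \<Otimes>\<^sub>M \<nu>)" by measurable
  ultimately show "AE x in \<mu>. gap a x (T' x) = 0"
    using AE_distrD[of "\<lambda>x. (x, T' x)" \<mu> "\<mu> \<Otimes>\<^sub>M \<nu>" "\<lambda>w. gap a (fst w) (snd w) = 0"]
    unfolding graph_def fst_conv snd_conv by blast
qed

lemma AE_optimal_map_in_atoms:
  assumes "optimal_transport_map \<mu> \<nu> c T"
  shows "AE x in \<mu>. T x \<in> y ` {1..n}"
proof -
  have T: "T \<in> measurable \<mu> \<nu>" using assms by (simp add: optimal_transport_map_def)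
  have push: "distr \<mu> \<nu> T = \<nu>"
    using assms graph_plan_iff[OF prob_source T] by (simp add: optimal_transport_map_def optimal_plan_def)
  show ?thesis using AE_distrD[OF T, of "\<lambda>z. z \<in> y ` {1..n}"] AE_atoms unfolding push by blast
qed

lemma maximizer_solves_transport:
  assumes a: "\<And>b. dual b \<le> dual a"
  shows "optimal_transport_map \<mu> \<nu> c (assignment a)"
    and "x \<in> strict_interior n (cell a) i \<Longrightarrow> i \<in> {1..n} \<Longrightarrow> assignment a x = y i"
    and "induces_partition \<mu> \<nu> A n y (cell a)"
    and "optimal_transport_map \<mu> \<nu> c T \<Longrightarrow> AE x in \<mu>. T x = assignment a x"
proof -
  have gap: "AE x in \<mu>. gap a x (assignment a x) = 0"
  proof (rule AE_I2)
    fix x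
    obtain i where "i \<in> {1..n}" "assignment a x = y i" "F a x = a i - c x (y i)"
      using assignment_in_cell by blast
    thus "gap a x (assignment a x) = 0" by (simp add: gap_at_atom)
  qed
  note opt = graph_gap_zero_imp_optimal[OF assignment_measurable assignment_pushforward[OF a] gap]
  show "optimal_transport_map \<mu> \<nu> c (assignment a)" by (rule opt(1))
  show "assignment a x = y i" if x: "x \<in> strict_interior n (cell a) i" and i: "i \<in> {1..n}"
  proof -
    obtain j where j: "j \<in> {1..n}" "assignment a x = y j" "F a x = a j - c x (y j)"
      using assignment_in_cell by blast
    have "x \<in> cell a i" using x by (simp add: strict_interior_def)
    hence "x \<in> cell a j" using j by (simp add: shift_cell_def)
    have "i = j"
    proof (rule ccontr)
      assume "i \<noteq> j"
      hence "x \<in> boundary_set n (cell a)"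
        using i j \<open>x \<in> cell a i\<close> \<open>x \<in> cell a j\<close>
        by (cases "i < j") (force simp: boundary_set_def)+
      thus False using x by (simp add: strict_interior_def)
    qed
    thus ?thesis using j by simp
  qed
  have A1: "measure \<mu> A = 1" using AE_A A_sets by (simp add: source.prob_eq_1)
  show "induces_partition \<mu> \<nu> A n y (cell a)"
    unfolding induces_partition_def
  proof (intro conjI ballI impI)
    show "emeasure \<mu> A < \<infinity>" by (simp add: source.emeasure_finite less_top[symmetric])
    fix i assume i: "i \<in> {1..n}"
    show "emeasure \<mu> (cell a i) = emeasure \<nu> {y i}"
      using maximizer_cell_mass[OF a i] by (simp add: source.emeasure_eq_measure target.emeasure_eq_measure)
    show "0 < emeasure \<nu> {y i}" using atom_pos[OF i] by (simp add: target.emeasure_eq_measure)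
    fix j assume j: "j \<in> {1..n}" "i \<noteq> j"
    have "AE x in \<mu>. x \<notin> cell a i \<inter> cell a j"
      using AE_unique_cell[of a]
    proof eventually_elim
      case (elim x)
      show ?case using cell_index_unique[OF elim, of i j] i j by blast
    qed
    thus "emeasure \<mu> (cell a i \<inter> cell a j) = 0"
      using i j by (subst AE_iff_measurable[symmetric, where P = "\<lambda>x. x \<notin> cell a i \<inter> cell a j"])
        (use sets.sets_into_space[OF cell_sets[OF i]] in auto)
  next
    show "(\<Sum>i=1..n. emeasure \<mu> (cell a i)) = emeasure \<mu> A"
      using sum_cells[of a] by (simp add: source.emeasure_eq_measure A1)
  qed
  show "AE x in \<mu>. T x = assignment a x" if T: "optimal_transport_map \<mu> \<nu> c T"
    using opt(2)[OF T] AE_optimal_map_in_atoms[OF T] AE_A AE_assignment[of a]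
  proof eventually_elim
    case (elim x)
    then obtain i where i: "i \<in> {1..n}" "T x = y i" by blast
    hence "x \<in> cell a i" using elim gap_eq_0_iff by metis
    thus ?case using elim i by simp
  qed
qed

end

section \<open>Measures on subsets of Euclidean space\<close>

text \<open>Every point outside the support has a null open neighbourhood, and by the Lindeloef property
  countably many of these cover the complement of the support.\<close>

lemma AE_in_closed_superset_of_support:
  fixes M :: "'a::second_countable_topology measure"
  assumes M: "sets M = sets (restrict_space borel X)" and A: "closed A" and supp: "measure_support M \<subseteq> A"
  shows "AE x in M. x \<in> A"
proof -
  have space: "space M = X" using sets_eq_imp_space_eq[OF M] by (simp add: space_restrict_space)
  have Int_sets: "U \<inter> space M \<in> sets M" if "U \<in> sets borel" for U
    unfolding M space using that by (auto simp: sets_restrict_space)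
  define \<U> where "\<U> = {U. open U \<and> emeasure M (U \<inter> space M) = 0}"
  obtain \<V> where \<V>: "\<V> \<subseteq> \<U>" "countable \<V>" "\<Union>\<V> = \<Union>\<U>"
    by (rule Lindelof[of \<U>]) (auto simp: \<U>_def)
  have "AE x in M. \<forall>U\<in>\<V>. x \<notin> U"
  proof (rule AE_ball_countable[THEN iffD2, OF \<V>(2)], rule ballI)
    fix U assume "U \<in> \<V>"
    hence U: "open U" "emeasure M (U \<inter> space M) = 0" using \<V>(1) by (auto simp: \<U>_def)
    hence "U \<inter> space M \<in> null_sets M" using Int_sets[of U] by auto
    thus "AE x in M. x \<notin> U" by (rule AE_I') auto
  qed
  thus ?thesis using AE_space
  proof eventually_elim
    case (elim x)
    show "x \<in> A"
    proof (rule ccontr)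
      assume "x \<notin> A"
      hence "x \<notin> measure_support M" using supp by blast
      then obtain U where "open U" "x \<in> U" "emeasure M (U \<inter> space M) = 0"
        using elim(2) by (auto simp: measure_support_def)
      hence "x \<in> \<Union>\<U>" by (auto simp: \<U>_def)
      thus False using elim(1) \<V>(3) by blast
    qed
  qed
qed

lemma AE_not_in_lebesgue_null:
  assumes ac: "lebesgue_abs_cont M" and M: "sets M = sets (restrict_space borel X)"
    and N: "N \<in> null_sets lborel"
  shows "AE x in M. x \<notin> N"
proof -
  have "(\<lambda>x. x) \<in> measurable (restrict_space borel X) borel" by (rule measurable_restrict_space1) simp
  hence id: "(\<lambda>x. x) \<in> measurable M borel" using measurable_cong_sets[OF M refl] by blast
  have "N \<in> null_sets (distr M borel (\<lambda>x. x))"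
    using ac N by (auto simp: lebesgue_abs_cont_def absolutely_continuous_def)
  hence "AE x in distr M borel (\<lambda>x. x). x \<notin> N" by (rule AE_not_in)
  thus ?thesis by (rule AE_distrD[OF id])
qed

section \<open>Optimal maps for p-norm costs\<close>

theorem theorem3p7:
  fixes X Y A :: "(real ^ 'd) set"
    and \<mu> \<nu> :: "(real ^ 'd) measure"
    and n :: nat
    and y :: "nat \<Rightarrow> real ^ 'd"
    and p :: real
    and c :: "real ^ 'd \<Rightarrow> real ^ 'd \<Rightarrow> real"
  assumes "CARD('d) \<ge> 2"
    and "borel_prob_on X \<mu>"
    and "lebesgue_abs_cont \<mu>"
    and "convex A" and "compact A" and "A \<subseteq> X"
    and "measure_support \<mu> \<subseteq> A"
    and "borel_prob_on Y \<nu>"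
    and "n \<ge> 2"
    and "inj_on y {1..n}"
    and "{z \<in> Y. emeasure \<nu> {z} \<noteq> 0} = y ` {1..n}"
    and "AE z in \<nu>. z \<in> y ` {1..n}"
    and "1 < p"
    and "c = (\<lambda>x z. lp_norm p (x - z))"
  shows "\<exists>(T :: real ^ 'd \<Rightarrow> real ^ 'd) (a :: nat \<Rightarrow> real) (C :: nat \<Rightarrow> (real ^ 'd) set).
           C = shift_cell c n y a A \<and>
           optimal_transport_map \<mu> \<nu> c T \<and>
           (\<forall>x\<in>A. \<forall>i\<in>{1..n}. x \<in> strict_interior n C i \<longrightarrow> T x = y i) \<and>
           induces_partition \<mu> \<nu> A n y C \<and>
           (\<forall>T'. optimal_transport_map \<mu> \<nu> c T' \<longrightarrow> (AE x in \<mu>. T' x = T x))"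
proof -
  have sets_\<mu>: "sets \<mu> = sets (restrict_space borel X)" and sets_\<nu>: "sets \<nu> = sets (restrict_space borel Y)"
    and prob: "prob_space \<mu>" "prob_space \<nu>"
    using assms(2,8) by (auto simp: borel_prob_on_def)
  interpret \<nu>: prob_space \<nu> by (rule prob(2))
  have atom: "y i \<in> Y" "emeasure \<nu> {y i} \<noteq> 0" if "i \<in> {1..n}" for i
    using that assms(11) by blast+
  have cont: "continuous_on UNIV (\<lambda>x. c x z)" for z
    unfolding assms(14) by (rule continuous_on_compose2[OF continuous_on_lp_norm[OF assms(13)]])
      (auto intro: continuous_intros)
  have "\<exists>k. \<forall>i\<in>{1..n}. \<forall>x\<in>A. c x (y i) \<le> k"
  proof -
    have "compact (\<Union>i\<in>{1..n}. (\<lambda>x. c x (y i)) ` A)"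
      using assms(5) cont by (intro compact_UN compact_continuous_image) (auto intro: continuous_on_subset)
    hence "bdd_above (\<Union>i\<in>{1..n}. (\<lambda>x. c x (y i)) ` A)" by (intro bounded_imp_bdd_above compact_imp_bounded)
    thus ?thesis by (auto simp: bdd_above_def)
  qed
  then obtain k where k: "\<forall>i\<in>{1..n}. \<forall>x\<in>A. c x (y i) \<le> k" by blast
  interpret semidiscrete_transport \<mu> \<nu> A c n y k
  proof (rule semidiscrete_transport.intro)
    show "A \<in> sets \<mu>"
      unfolding sets_\<mu> sets_restrict_space using assms(5,6) borel_compact by blast
    show "AE x in \<mu>. x \<in> A"
      using AE_in_closed_superset_of_support[OF sets_\<mu> compact_imp_closed[OF assms(5)] assms(7)] .
    show "1 \<le> n" using assms(9) by simp
    show "{y i} \<in> sets \<nu>" if "i \<in> {1..n}" for i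
      unfolding sets_\<nu> sets_restrict_space using atom(1)[OF that] by (intro image_eqI[of _ _ "{y i}"]) auto
    show "0 < measure \<nu> {y i}" if "i \<in> {1..n}" for i
      using atom(2)[OF that] by (simp add: \<nu>.emeasure_eq_measure zero_less_measure_iff)
    show "(\<lambda>x. c x (y i)) \<in> borel_measurable \<mu>" for i
    proof -
      have "(\<lambda>x. c x (y i)) \<in> borel_measurable (restrict_space borel X)"
        using cont by (intro measurable_restrict_space1 borel_measurable_continuous_onI)
      thus ?thesis using measurable_cong_sets[OF sets_\<mu> refl] by blast
    qed
    show "0 \<le> c x (y i)" for x i by (simp add: assms(14) lp_norm_nonneg)
    show "c x (y i) \<le> k" if "x \<in> A" "i \<in> {1..n}" for x i using k that by blast
    show "AE x in \<mu>. c x (y i) - c x (y j) \<noteq> r" if "i \<in> {1..n}" "j \<in> {1..n}" "i \<noteq> j" for i j r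
    proof -
      have "y i \<noteq> y j" using inj_onD[OF assms(10) _ that(1,2)] that(3) by blast
      from AE_not_in_lebesgue_null[OF assms(3) sets_\<mu>
          lp_norm_difference_level_set_null[OF assms(1,13) this, of r]]
      show ?thesis by (simp only: assms(14) mem_Collect_eq not_False_eq_True)
    qed
  qed (fact prob(1) prob(2) assms(10) assms(12))+
  obtain a where a: "\<And>b. dual b \<le> dual a" using dual_maximizer by blast
  note sol = maximizer_solves_transport[OF a]
  show ?thesis
    by (intro exI[of _ "assignment a"] exI[of _ a] exI[of _ "cell a"] conjI ballI allI impI refl)
      (fact sol(1) sol(3) | erule (1) sol(2) | erule sol(4))+
qed

end
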